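(* For any positive integer $j$ and for any graph $G=(V,E)$, $$w_j(G)\leq\gamma_j(G)\leq z_j(G),$$ where $\gamma_j(G)$ is the $j$-domination number of $G$ and $w_j(G)$, $z_j(G)$ are the degree-sequence indices defined in the context.
   Context: All graphs are simple and finite. For $G=(V,E)$, $n=|V|$, $m(G)=|E|$, and $d_1\le d_2\le\dots\le d_n$ is the degree sequence of $G$ in non-decreasing order. For $S\subseteq V$, $m[S]$ is the number of edges of the subgraph induced by $S$. A $j$-dominating set is a set $D\subseteq V$ such that each vertex of $V-D$ has at least $j$ neighbors in $D$; $\gamma_j(G)$ is the cardinality of a smallest $j$-dominating set. Let $F$ be the family of all minimum (i.e. smallest-cardinality) $j$-dominating sets of $G$. Define (with $k$ ranging over integers $0\le k\le n$) $$z_j(G)=\max\Big\{k : \sum_{i=1}^k d_i+\max_{S\in F}\{m[V-S]-m[S]\}\le m(G)\Big\},$$ $$w_j(G)=\min\Big\{k : \sum_{i=1}^k d_{n-i+1}+\min_{S\in F}\{m[V-S]-m[S]\}\ge m(G)\Big\}.$$ *)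

theory Defs
  imports Main "HOL-Library.Multiset"
begin

text \<open>A finite simple graph is a finite vertex set \<open>V\<close> together with a set \<open>E\<close> of two-element
  subsets of \<open>V\<close>. The graph with no vertices is allowed.\<close>

definition fin_simple_graph :: "'a set \<Rightarrow> 'a set set \<Rightarrow> bool" where
  "fin_simple_graph V E \<longleftrightarrow> finite V \<and> (\<forall>e\<in>E. e \<subseteq> V \<and> card e = 2)"

definition neighbours :: "'a set set \<Rightarrow> 'a \<Rightarrow> 'a set" where
  "neighbours E v = {u. {u, v} \<in> E}"

definition degree :: "'a set set \<Rightarrow> 'a \<Rightarrow> nat" where
  "degree E v = card (neighbours E v)"

definition degree_list :: "'a set \<Rightarrow> 'a set set \<Rightarrow> nat list" where
  "degree_list V E = sorted_list_of_multiset (image_mset (degree E) (mset_set V))"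

text \<open>The degree sequence \<open>d\<^sub>1 \<le> \<dots> \<le> d\<^sub>n\<close> is indexed from 1, lists from 0. The value is
  meaningful only for \<open>1 \<le> i \<le> card V\<close>.\<close>

definition deg_seq :: "'a set \<Rightarrow> 'a set set \<Rightarrow> nat \<Rightarrow> nat" where
  "deg_seq V E i = degree_list V E ! (i - 1)"

definition induced_edges :: "'a set set \<Rightarrow> 'a set \<Rightarrow> 'a set set" where
  "induced_edges E S = {e \<in> E. e \<subseteq> S}"

definition m_induced :: "'a set set \<Rightarrow> 'a set \<Rightarrow> nat" where
  "m_induced E S = card (induced_edges E S)"

definition j_dominating :: "'a set \<Rightarrow> 'a set set \<Rightarrow> nat \<Rightarrow> 'a set \<Rightarrow> bool" where
  "j_dominating V E j D \<longleftrightarrow> D \<subseteq> V \<and> (\<forall>v\<in>V - D. card (neighbours E v \<inter> D) \<ge> j)"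

definition domination_number :: "'a set \<Rightarrow> 'a set set \<Rightarrow> nat \<Rightarrow> nat" where
  "domination_number V E j = Min (card ` {D. j_dominating V E j D})"

definition min_dominating_sets :: "'a set \<Rightarrow> 'a set set \<Rightarrow> nat \<Rightarrow> 'a set set" where
  "min_dominating_sets V E j = {D. j_dominating V E j D \<and> card D = domination_number V E j}"

text \<open>The difference \<open>m[V - S] - m[S]\<close> can be negative, so it is taken in the integers.\<close>

definition edge_excess :: "'a set \<Rightarrow> 'a set set \<Rightarrow> 'a set \<Rightarrow> int" where
  "edge_excess V E S = int (m_induced E (V - S)) - int (m_induced E S)"

definition z_index :: "'a set \<Rightarrow> 'a set set \<Rightarrow> nat \<Rightarrow> nat" where
  "z_index V E j = Max {k. k \<le> card V \<and>
     (\<Sum>i=1..k. int (deg_seq V E i)) + Max (edge_excess V E ` min_dominating_sets V E j)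
       \<le> int (card E)}"

definition w_index :: "'a set \<Rightarrow> 'a set set \<Rightarrow> nat \<Rightarrow> nat" where
  "w_index V E j = Min {k. k \<le> card V \<and>
     (\<Sum>i=1..k. int (deg_seq V E (card V - i + 1))) + Min (edge_excess V E ` min_dominating_sets V E j)
       \<ge> int (card E)}"

end

theory Submission
  imports Defs
begin

text \<open>Counting edges by how many endpoints lie in a vertex set \<open>S\<close> gives the identity
  \<open>(\<Sum>v\<in>S. deg v) + m[V - S] - m[S] = m(G)\<close>: an edge inside \<open>S\<close> is counted twice by the
  degree sum and subtracted once, an edge inside \<open>V - S\<close> is counted only by \<open>m[V - S]\<close>, and a
  crossing edge is counted once by the degree sum
  (\<open>degree_sum_plus_edge_excess\<close>).

  The degree sum of a set of \<open>k\<close> vertices lies between the sums of the \<open>k\<close> smallest and of the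
  \<open>k\<close> largest degrees (\<open>sum_smallest_degrees_le\<close>, \<open>sum_le_sum_largest_degrees\<close>).
  Applied to a minimum \<open>j\<close>-dominating set whose edge excess is as large as possible, the identity
  therefore shows that \<open>k = \<gamma>\<^sub>j\<close> satisfies the inequality whose largest solution is \<open>z\<^sub>j\<close>.
  Applied to one whose edge excess is as small as possible, it shows that \<open>\<gamma>\<^sub>j\<close> satisfies the
  inequality whose least solution is \<open>w\<^sub>j\<close>.
  Such sets exist because \<open>V\<close> itself is \<open>j\<close>-dominating and has finitely many subsets.\<close>

text \<open>Compare the head of the list with an element of the multiset, chosen to be the head itself
  when it occurs there: deleting both leaves a multiset contained in the tail.\<close>

lemma sum_list_take_le_sum_mset:
  fixes xs :: "nat list"
  assumes "sorted xs" "M \<subseteq># mset xs"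
  shows "sum_list (take (size M) xs) \<le> sum_mset M"
  using assms
proof (induction xs arbitrary: M)
  case Nil
  then show ?case by simp
next
  case (Cons x xs)
  show ?case
  proof (cases "M = {#}")
    case False
    obtain y where y: "y \<in># M" "x \<le> y" "M - {#y#} \<subseteq># mset xs"
    proof (cases "x \<in># M")
      case True
      with Cons.prems(2) that[of x] show thesis
        by (simp add: subset_eq_diff_conv)
    next
      case nin: False
      have sub: "M \<subseteq># mset xs"
        using Cons.prems(2) nin by (metis add_mset_remove_trivial diff_single_trivial mset.simps(2)
            subset_eq_diff_conv add_mset_add_single)
      obtain y where "y \<in># M" using \<open>M \<noteq> {#}\<close> by blast
      moreover have "x \<le> y"
        using \<open>y \<in># M\<close> sub Cons.prems(1) by (auto dest: mset_subset_eqD)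
      ultimately show thesis
        using that sub by (meson diff_subset_eq_self subset_mset.order_trans)
    qed
    have M: "M = add_mset y (M - {#y#})" using y(1) by simp
    have "sum_list (take (size (M - {#y#})) xs) \<le> sum_mset (M - {#y#})"
      using Cons.IH y(3) Cons.prems(1) by simp
    then show ?thesis using y(2) by (subst (1 2) M) simp
  qed simp
qed

text \<open>The elements outside \<open>M\<close> sum to at least as much as the same number of smallest entries,
  so \<open>M\<close> sums to at most what remains.\<close>

lemma sum_mset_le_sum_list_take_rev:
  fixes xs :: "nat list"
  assumes "sorted xs" "M \<subseteq># mset xs"
  shows "sum_mset M \<le> sum_list (take (size M) (rev xs))"
proof -
  let ?k = "length xs - size M"
  have "sum_list (take ?k xs) \<le> sum_mset (mset xs - M)"
    using sum_list_take_le_sum_mset[OF assms(1), of "mset xs - M"] assms(2)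
    by (simp add: size_Diff_submset)
  moreover have "sum_mset M + sum_mset (mset xs - M) = sum_list xs"
    using assms(2) by (metis subset_mset.add_diff_inverse sum_mset.union sum_mset_sum_list)
  moreover have "sum_list (take ?k xs) + sum_list (drop ?k xs) = sum_list xs"
    by (metis append_take_drop_id sum_list_append)
  moreover have "sum_list (take (size M) (rev xs)) = sum_list (drop ?k xs)"
    by (simp add: take_rev)
  ultimately show ?thesis by linarith
qed

lemma length_degree_list: "length (degree_list V E) = card V"
  by (metis degree_list_def mset_sorted_list_of_multiset size_image_mset size_mset size_mset_set)

lemma sorted_degree_list: "sorted (degree_list V E)"
  by (simp add: degree_list_def)

lemma degrees_subset_degree_list:
  assumes "finite V" "S \<subseteq> V"
  shows "image_mset (degree E) (mset_set S) \<subseteq># mset (degree_list V E)"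
  using assms by (simp add: degree_list_def image_mset_subseteq_mono subset_imp_msubset_mset_set)

lemma sum_smallest_degrees_le:
  assumes "finite V" "S \<subseteq> V"
  shows "(\<Sum>i=1..card S. deg_seq V E i) \<le> (\<Sum>v\<in>S. degree E v)"
proof -
  have "card S \<le> card V" using assms by (simp add: card_mono)
  then have "(\<Sum>i=1..card S. deg_seq V E i) = sum_list (take (card S) (degree_list V E))"
    by (simp add: deg_seq_def sum.atLeast1_atMost_eq sum_list_sum_nth length_degree_list
        atLeast0LessThan)
  also have "\<dots> \<le> (\<Sum>v\<in>S. degree E v)"
    using sum_list_take_le_sum_mset[OF sorted_degree_list degrees_subset_degree_list[OF assms]]
    by (simp add: sum_unfold_sum_mset)
  finally show ?thesis .
qed

lemma sum_le_sum_largest_degrees: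
  assumes "finite V" "S \<subseteq> V"
  shows "(\<Sum>v\<in>S. degree E v) \<le> (\<Sum>i=1..card S. deg_seq V E (card V - i + 1))"
proof -
  have "card S \<le> card V" using assms by (simp add: card_mono)
  then have "(\<Sum>i=1..card S. deg_seq V E (card V - i + 1))
      = sum_list (take (card S) (rev (degree_list V E)))"
    by (simp add: deg_seq_def sum.atLeast1_atMost_eq sum_list_sum_nth length_degree_list
        atLeast0LessThan rev_nth)
  moreover have "(\<Sum>v\<in>S. degree E v) \<le> sum_list (take (card S) (rev (degree_list V E)))"
    using sum_mset_le_sum_list_take_rev[OF sorted_degree_list degrees_subset_degree_list[OF assms]]
    by (simp add: sum_unfold_sum_mset)
  ultimately show ?thesis by simp
qed

lemma finite_edges:
  assumes "fin_simple_graph V E"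
  shows "finite E"
  using assms unfolding fin_simple_graph_def
  by (meson PowI finite_Pow_iff finite_subset subsetI)

lemma degree_eq_card_incident_edges:
  assumes "fin_simple_graph V E"
  shows "degree E v = card {e \<in> E. v \<in> e}"
proof -
  have "bij_betw (\<lambda>u. {u, v}) (neighbours E v) {e \<in> E. v \<in> e}"
  proof (rule bij_betw_imageI)
    show "inj_on (\<lambda>u. {u, v}) (neighbours E v)"
      by (auto simp: inj_on_def doubleton_eq_iff)
    show "(\<lambda>u. {u, v}) ` neighbours E v = {e \<in> E. v \<in> e}"
    proof (intro equalityI subsetI)
      fix e assume e: "e \<in> {e \<in> E. v \<in> e}"
      then have "card e = 2" using assms by (auto simp: fin_simple_graph_def)
      then obtain u where "e = {u, v}" using e by (auto simp: card_2_iff)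
      then show "e \<in> (\<lambda>u. {u, v}) ` neighbours E v"
        using e by (auto simp: neighbours_def)
    qed (auto simp: neighbours_def)
  qed
  then show ?thesis by (simp add: degree_def bij_betw_same_card)
qed

lemma sum_degree_eq_sum_card_inter:
  assumes "fin_simple_graph V E" "S \<subseteq> V"
  shows "(\<Sum>v\<in>S. degree E v) = (\<Sum>e\<in>E. card (e \<inter> S))"
proof -
  have "finite S" using assms by (auto simp: fin_simple_graph_def intro: finite_subset)
  then have "(\<Sum>v\<in>S. card {e \<in> E. v \<in> e}) = (\<Sum>e\<in>E. card {v \<in> S. v \<in> e})"
    using finite_edges[OF assms(1)] by (intro sum_multicount_gen) auto
  moreover have "{v \<in> S. v \<in> e} = e \<inter> S" for e by auto
  ultimately show ?thesis by (simp add: degree_eq_card_incident_edges[OF assms(1)])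
qed

text \<open>Each edge contributes exactly 1 to the left-hand side: \<open>2 - 1\<close> with both endpoints in \<open>S\<close>,
  \<open>1\<close> with one, and \<open>0 + 1\<close> with none.\<close>

lemma degree_sum_plus_edge_excess:
  assumes G: "fin_simple_graph V E" and S: "S \<subseteq> V"
  shows "int (\<Sum>v\<in>S. degree E v) + edge_excess V E S = int (card E)"
proof -
  note fin = finite_edges[OF G]
  have edge: "int (card (e \<inter> S)) + of_bool (e \<subseteq> V - S) - of_bool (e \<subseteq> S) = 1" if "e \<in> E" for e
  proof -
    have "e \<subseteq> V" "card e = 2" using G that by (auto simp: fin_simple_graph_def)
    then obtain u v where "e = {u, v}" "u \<noteq> v" "u \<in> V" "v \<in> V" by (auto simp: card_2_iff)
    then show ?thesis by (cases "u \<in> S"; cases "v \<in> S") auto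
  qed
  have ind: "int (m_induced E T) = (\<Sum>e\<in>E. of_bool (e \<subseteq> T))" for T
    using fin by (simp add: m_induced_def induced_edges_def Int_def)
  have "int (\<Sum>v\<in>S. degree E v) + edge_excess V E S
      = (\<Sum>e\<in>E. int (card (e \<inter> S)) + of_bool (e \<subseteq> V - S) - of_bool (e \<subseteq> S))"
    unfolding edge_excess_def ind sum_degree_eq_sum_card_inter[OF G S]
    by (simp add: sum.distrib sum_subtractf)
  also have "\<dots> = int (card E)" using edge by simp
  finally show ?thesis .
qed

lemma finite_j_dominating:
  assumes "finite V"
  shows "finite {D. j_dominating V E j D}"
  using assms by (rule_tac finite_subset[of _ "Pow V"]) (auto simp: j_dominating_def)

text \<open>The whole vertex set is \<open>j\<close>-dominating, so the minimum is attained.\<close>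

lemma min_dominating_sets_nonempty:
  assumes "finite V"
  shows "min_dominating_sets V E j \<noteq> {}"
proof -
  let ?F = "{D. j_dominating V E j D}"
  have "V \<in> ?F" by (simp add: j_dominating_def)
  then have "Min (card ` ?F) \<in> card ` ?F"
    using finite_j_dominating[OF assms] by (intro Min_in) auto
  then show ?thesis by (auto simp: min_dominating_sets_def domination_number_def)
qed

theorem theorem5p2:
  fixes V :: "'a set" and E :: "'a set set" and j :: nat
  assumes "fin_simple_graph V E"
    and "j \<ge> 1"
  shows "w_index V E j \<le> domination_number V E j \<and> domination_number V E j \<le> z_index V E j"
proof -
  let ?F = "min_dominating_sets V E j" and ?g = "domination_number V E j"
  let ?X = "edge_excess V E ` ?F"
  have finV: "finite V" using assms(1) by (simp add: fin_simple_graph_def)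
  have X: "finite ?X" "?X \<noteq> {}"
    using min_dominating_sets_nonempty[OF finV] finite_j_dominating[OF finV]
    by (auto simp: min_dominating_sets_def)
  have F: "D \<subseteq> V" "card D = ?g" if "D \<in> ?F" for D
    using that by (auto simp: min_dominating_sets_def j_dominating_def)
  obtain S where S: "S \<in> ?F" "edge_excess V E S = Max ?X"
    using Max_in[OF X] by (metis imageE)
  obtain T where T: "T \<in> ?F" "edge_excess V E T = Min ?X"
    using Min_in[OF X] by (metis imageE)
  have le: "?g \<le> card V" using F[OF S(1)] finV by (metis card_mono)
  have z: "(\<Sum>i=1..?g. int (deg_seq V E i)) + Max ?X \<le> int (card E)"
    using degree_sum_plus_edge_excess[OF assms(1) F(1)[OF S(1)]] S(2)
      sum_smallest_degrees_le[OF finV F(1)[OF S(1)], of E, unfolded F(2)[OF S(1)]]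
    unfolding of_nat_sum[symmetric] by linarith
  have w: "(\<Sum>i=1..?g. int (deg_seq V E (card V - i + 1))) + Min ?X \<ge> int (card E)"
    using degree_sum_plus_edge_excess[OF assms(1) F(1)[OF T(1)]] T(2)
      sum_le_sum_largest_degrees[OF finV F(1)[OF T(1)], of E, unfolded F(2)[OF T(1)]]
    unfolding of_nat_sum[symmetric] by linarith
  show ?thesis
  proof
    show "w_index V E j \<le> ?g"
      unfolding w_index_def using le w by (intro Min_le) auto
    show "?g \<le> z_index V E j"
      unfolding z_index_def using le z by (intro Max_ge) auto
  qed
qed

end
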